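(* Let $S(s,t;z)=\sum_{n\ge1}\sum_{\pi\in\mathfrak S_n(2413,4213)}s^{\mathrm{ides}(\pi)}t^{\mathrm{des}(\pi)}z^n$. Then, as formal power series in $z$, $$S(s,t;z)=t\big(z(s-1)+1\big)S(s,t;z)^3+tz(2s-1)S(s,t;z)^2+z(ts+1)S(s,t;z)+z.$$ In particular $S(1,t;z)=tS(1,t;z)^3+tzS(1,t;z)^2+z(t+1)S(1,t;z)+z$ and $S(s,1;z)=(sz-z+1)S(s,1;z)^2+szS(s,1;z)+z$.
   Context: $\mathfrak S_n(2413,4213)$ is the set of permutations of $[n]$ avoiding the patterns $2413$ and $4213$ (no subsequence order isomorphic to either). $\mathrm{des}(\pi)=|\{i\in[n-1]:\pi_i>\pi_{i+1}\}|$ and $\mathrm{ides}(\pi)=\mathrm{des}(\pi^{-1})$. *)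

theory Defs
  imports "HOL-Computational_Algebra.Formal_Power_Series"
begin

text \<open>Permutations of [n] are represented as lists (one-line notation) containing
  each of 1..n exactly once.\<close>
definition perms :: "nat \<Rightarrow> nat list set" where
  "perms n = {xs. distinct xs \<and> set xs = {1..n}}"

definition contains :: "nat list \<Rightarrow> nat list \<Rightarrow> bool" where
  "contains \<pi> p \<longleftrightarrow> (\<exists>f. strict_mono_on {..<length p} f \<and> (\<forall>i<length p. f i < length \<pi>) \<and>
     (\<forall>i<length p. \<forall>j<length p. (\<pi> ! f i < \<pi> ! f j \<longleftrightarrow> p ! i < p ! j)))"

definition avoiders :: "nat \<Rightarrow> nat list set" where
  "avoiders n = {\<pi> \<in> perms n. \<not> contains \<pi> [2,4,1,3] \<and> \<not> contains \<pi> [4,2,1,3]}"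

definition des :: "nat list \<Rightarrow> nat" where
  "des \<pi> = card {i. Suc i < length \<pi> \<and> \<pi> ! i > \<pi> ! Suc i}"

definition inv_perm :: "nat list \<Rightarrow> nat list" where
  "inv_perm \<pi> = map (\<lambda>v. Suc (LEAST i. i < length \<pi> \<and> \<pi> ! i = v)) [1..<Suc (length \<pi>)]"

definition ides :: "nat list \<Rightarrow> nat" where
  "ides \<pi> = des (inv_perm \<pi>)"

definition S_gf :: "'a::comm_ring_1 \<Rightarrow> 'a \<Rightarrow> 'a fps" where
  "S_gf s t = Abs_fps (\<lambda>n. if n = 0 then 0 else (\<Sum>\<pi>\<in>avoiders n. s ^ ides \<pi> * t ^ des \<pi>))"

end

theory Submission
  imports Defs
begin

text \<open>
  Write an avoider as \<open>\<pi> = A 1 B\<close>. If \<open>A\<close> is nonempty, its letters form an interval of values, so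
  \<open>\<pi>\<close> is determined by the standardisation \<open>\<alpha>\<close> of \<open>A\<close> and by the word \<open>\<sigma> = a B\<close> obtained by deleting 1
  and contracting \<open>A\<close> to a single letter \<open>a\<close>; moreover \<open>\<pi>\<close> is an avoider iff \<open>\<alpha>\<close> and \<open>\<sigma>\<close> are.
  Under this bijection \<open>des \<pi> = des \<alpha> + 1 + des B\<close> and \<open>ides \<pi> = ides \<alpha> + ides \<sigma> + [a = 1]\<close>.

  Let \<open>D\<close> count the avoiders that begin with a descent, and \<open>W\<close> all nonempty ones with weight
  \<open>s^(ides \<sigma> + [a = 1]) t^(des B)\<close>; in \<open>D\<close> the initial descent is not counted by \<open>t\<close>. Then
  \<open>S = z(1 + S) + tSW\<close>, \<open>D = (tD + z)W\<close> and \<open>W = S + (s - 1)z(1 + S) + (1 - t)D\<close>. The first two give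
  \<open>D(1 + S) = WS\<close>, and eliminating \<open>D\<close> and \<open>W\<close> yields the cubic. At \<open>t = 1\<close> the cubic is \<open>1 + S\<close>
  times the quadratic.
\<close>

unbundle fps_syntax

section \<open>Order of appearance of letters in a word\<close>

text \<open>Relating letters instead of positions gives simple rules for append and map, so words
  cut into blocks and relabelled need no index arithmetic.\<close>

primrec before :: "'a list \<Rightarrow> 'a \<Rightarrow> 'a \<Rightarrow> bool" where
  "before [] x y \<longleftrightarrow> False"
| "before (z # zs) x y \<longleftrightarrow> x = z \<and> y \<in> set zs \<or> before zs x y"

lemma before_append:
  "before (xs @ ys) x y \<longleftrightarrow> before xs x y \<or> before ys x y \<or> x \<in> set xs \<and> y \<in> set ys"
  by (induction xs) auto

lemma before_map:
  "before (map f xs) u v \<longleftrightarrow> (\<exists>x y. before xs x y \<and> u = f x \<and> v = f y)"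
  by (induction xs) auto

lemma before_in_set: "before xs x y \<Longrightarrow> x \<in> set xs \<and> y \<in> set xs"
  by (induction xs) auto

text \<open>Bridge to \<open>contains\<close> and \<open>inv_perm\<close>, which speak of
  positions.\<close>

lemma before_iff_nth:
  "before xs x y \<longleftrightarrow> (\<exists>i j. i < j \<and> j < length xs \<and> xs ! i = x \<and> xs ! j = y)"
proof (induction xs)
  case Nil
  then show ?case by simp
next
  case (Cons z zs)
  show ?case (is "_ \<longleftrightarrow> ?R")
  proof
    assume "before (z # zs) x y"
    then consider "x = z" "y \<in> set zs" | "before zs x y" by auto
    then show ?R
    proof cases
      case 1
      then obtain j where "j < length zs" "zs ! j = y" by (auto simp: in_set_conv_nth)
      then show ?thesis using 1 by (intro exI[of _ 0] exI[of _ "Suc j"]) auto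
    next
      case 2
      then obtain i j where "i < j" "j < length zs" "zs ! i = x" "zs ! j = y"
        using Cons.IH by auto
      then show ?thesis by (intro exI[of _ "Suc i"] exI[of _ "Suc j"]) auto
    qed
  next
    assume ?R
    then obtain i j where ij: "i < j" "j < length (z # zs)" "(z # zs) ! i = x" "(z # zs) ! j = y"
      by blast
    then obtain j' where j': "j = Suc j'" by (cases j) auto
    show "before (z # zs) x y"
    proof (cases i)
      case 0
      then show ?thesis using ij j' by auto
    next
      case (Suc i')
      then have "before zs x y" using ij j' Cons.IH by auto
      then show ?thesis by simp
    qed
  qed
qed

section \<open>Avoidance of both patterns as one condition on letters\<close>

text \<open>The two patterns differ only in the order of their first two letters, so both are excluded at
  once by forbidding 2 and 4, in any order, before 1 before 3.\<close>

definition avoids :: "nat list \<Rightarrow> bool" where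
  "avoids xs \<longleftrightarrow> (\<forall>a b c d. before xs b a \<longrightarrow> before xs d a \<longrightarrow> before xs a c \<longrightarrow>
     \<not> (a < b \<and> b < c \<and> c < d))"

lemma avoids_Nil [simp]: "avoids []"
  by (simp add: avoids_def)

text \<open>A map keeping both the order of appearance and the order of values carries a forbidden
  quadruple of \<open>xs\<close> to one of \<open>ys\<close>. This serves every passage to a subword
  or a relabelling.\<close>

lemma avoids_embedding:
  assumes "avoids ys"
    and "\<And>x y. before xs x y \<Longrightarrow> before ys (h x) (h y)"
    and "\<And>x y. x \<in> set xs \<Longrightarrow> y \<in> set xs \<Longrightarrow> x < y \<Longrightarrow> h x < h y"
  shows "avoids xs"
  unfolding avoids_def
proof (intro allI impI notI)
  fix a b c d
  assume *: "before xs b a" "before xs d a" "before xs a c" "a < b \<and> b < c \<and> c < d"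
  then have "h a < h b" "h b < h c" "h c < h d"
    using assms(3) before_in_set by metis+
  moreover have "before ys (h b) (h a)" "before ys (h d) (h a)" "before ys (h a) (h c)"
    using * assms(2) by auto
  ultimately show False using assms(1) unfolding avoids_def by blast
qed

lemma strict_mono_on_nth4:
  fixes i j k l :: nat
  assumes "i < j" "j < k" "k < l"
  shows "strict_mono_on {..<4} ((!) [i, j, k, l])"
  using assms by (auto simp: strict_mono_on_def less_Suc_eq numeral_eq_Suc)

lemma contains4I:
  fixes i j k l :: nat
  assumes "i < j" "j < k" "k < l" "l < length \<pi>" and "length p = 4"
    and "\<And>x y. x < 4 \<Longrightarrow> y < 4 \<Longrightarrow>
      (\<pi> ! ([i, j, k, l] ! x) < \<pi> ! ([i, j, k, l] ! y) \<longleftrightarrow> p ! x < p ! y)"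
  shows "contains \<pi> p"
  unfolding contains_def
proof (intro exI[of _ "(!) [i, j, k, l]"] conjI allI impI)
  show "strict_mono_on {..<length p} ((!) [i, j, k, l])"
    using strict_mono_on_nth4 assms by simp
  show "[i, j, k, l] ! x < length \<pi>" if "x < length p" for x
    using that assms(1-5) by (auto simp: less_Suc_eq numeral_eq_Suc)
qed (use assms in auto)

lemma contains4E:
  assumes "contains \<pi> p" "length p = 4"
  obtains f :: "nat \<Rightarrow> nat" where "f 0 < f 1" "f 1 < f 2" "f 2 < f 3" "f 3 < length \<pi>"
    "\<And>i j. i < 4 \<Longrightarrow> j < 4 \<Longrightarrow> (\<pi> ! f i < \<pi> ! f j \<longleftrightarrow> p ! i < p ! j)"
proof -
  obtain f where f: "strict_mono_on {..<4::nat} f" "\<forall>i<4. f i < length \<pi>"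
    "\<forall>i<4. \<forall>j<4. (\<pi> ! f i < \<pi> ! f j \<longleftrightarrow> p ! i < p ! j)"
    using assms unfolding contains_def by auto
  then show thesis by (intro that[of f]) (auto simp: strict_mono_on_def)
qed

text \<open>In a forbidden quadruple, \<open>b\<close> before \<open>d\<close> gives 2413 and
  \<open>d\<close> before \<open>b\<close> gives 4213. Distinctness lets the three
  \<open>before\<close> facts share a single position of \<open>a\<close>.\<close>

lemma avoids_iff:
  assumes "distinct \<pi>"
  shows "avoids \<pi> \<longleftrightarrow> \<not> contains \<pi> [2,4,1,3] \<and> \<not> contains \<pi> [4,2,1,3]"
proof -
  have "contains \<pi> [2,4,1,3] \<or> contains \<pi> [4,2,1,3]" if na: "\<not> avoids \<pi>"
  proof -
    obtain a b c d where *: "before \<pi> b a" "before \<pi> d a" "before \<pi> a c" "a < b" "b < c" "c < d"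
      using na unfolding avoids_def by blast
    obtain ib ia where 1: "ib < ia" "ia < length \<pi>" "\<pi> ! ib = b" "\<pi> ! ia = a"
      using *(1) by (auto simp: before_iff_nth)
    obtain id where 2: "id < ia" "\<pi> ! id = d"
      using *(2) 1 assms by (auto simp: before_iff_nth nth_eq_iff_index_eq)
    obtain ic where 3: "ia < ic" "ic < length \<pi>" "\<pi> ! ic = c"
      using *(3) 1 assms by (auto simp: before_iff_nth nth_eq_iff_index_eq)
    have "ib \<noteq> id" using 1 2 * by auto
    then consider "ib < id" | "id < ib" by linarith
    then show ?thesis
    proof cases
      case 1
      have "contains \<pi> [2,4,1,3]"
        by (rule contains4I[of ib id ia ic])
           (use 1 2 3 * \<open>\<pi> ! ib = b\<close> \<open>\<pi> ! ia = a\<close> in \<open>auto simp: less_Suc_eq numeral_eq_Suc\<close>)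
      then show ?thesis ..
    next
      case 2
      have "contains \<pi> [4,2,1,3]"
        by (rule contains4I[of id ib ia ic])
           (use 1 2 3 * \<open>\<pi> ! id = d\<close> in \<open>auto simp: less_Suc_eq numeral_eq_Suc\<close>)
      then show ?thesis ..
    qed
  qed
  moreover have "\<not> avoids \<pi>" if con: "contains \<pi> [2,4,1,3]"
  proof -
    obtain f where f: "f 0 < f 1" "f 1 < f 2" "f 2 < f 3" "f 3 < length \<pi>"
      "\<And>i j. i < 4 \<Longrightarrow> j < 4 \<Longrightarrow> (\<pi> ! f i < \<pi> ! f j \<longleftrightarrow> ([2,4,1,3] :: nat list) ! i < [2,4,1,3] ! j)"
      by (rule contains4E[OF con]) auto
    then have "before \<pi> (\<pi> ! f 0) (\<pi> ! f 2)" "before \<pi> (\<pi> ! f 1) (\<pi> ! f 2)"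
      "before \<pi> (\<pi> ! f 2) (\<pi> ! f 3)"
      unfolding before_iff_nth using order.strict_trans by blast+
    moreover have "\<pi> ! f 2 < \<pi> ! f 0" "\<pi> ! f 0 < \<pi> ! f 3" "\<pi> ! f 3 < \<pi> ! f 1"
      using f(5)[of 2 0] f(5)[of 0 3] f(5)[of 3 1] by auto
    ultimately show ?thesis unfolding avoids_def by blast
  qed
  moreover have "\<not> avoids \<pi>" if con: "contains \<pi> [4,2,1,3]"
  proof -
    obtain f where f: "f 0 < f 1" "f 1 < f 2" "f 2 < f 3" "f 3 < length \<pi>"
      "\<And>i j. i < 4 \<Longrightarrow> j < 4 \<Longrightarrow> (\<pi> ! f i < \<pi> ! f j \<longleftrightarrow> ([4,2,1,3] :: nat list) ! i < [4,2,1,3] ! j)"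
      by (rule contains4E[OF con]) auto
    then have "before \<pi> (\<pi> ! f 1) (\<pi> ! f 2)" "before \<pi> (\<pi> ! f 0) (\<pi> ! f 2)"
      "before \<pi> (\<pi> ! f 2) (\<pi> ! f 3)"
      unfolding before_iff_nth using order.strict_trans by blast+
    moreover have "\<pi> ! f 2 < \<pi> ! f 1" "\<pi> ! f 1 < \<pi> ! f 3" "\<pi> ! f 3 < \<pi> ! f 0"
      using f(5)[of 2 1] f(5)[of 1 3] f(5)[of 3 0] by auto
    ultimately show ?thesis unfolding avoids_def by blast
  qed
  ultimately show ?thesis by blast
qed

lemma avoiders_iff:
  "\<pi> \<in> avoiders n \<longleftrightarrow> distinct \<pi> \<and> set \<pi> = {1..n} \<and> avoids \<pi>"
  using avoids_iff by (auto simp: avoiders_def perms_def)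

lemma avoiders_0: "avoiders 0 = {[]}"
  by (auto simp: avoiders_iff)

lemma length_avoiders: "\<pi> \<in> avoiders n \<Longrightarrow> length \<pi> = n"
  by (auto simp: avoiders_iff dest!: distinct_card)

lemma finite_avoiders: "finite (avoiders n)"
proof (rule finite_subset)
  show "avoiders n \<subseteq> {xs. set xs \<subseteq> {1..n} \<and> length xs = n}"
    using length_avoiders by (auto simp: avoiders_iff)
qed (simp add: finite_lists_length_eq)

section \<open>Descents and inverse descents\<close>

lemma des_Nil [simp]: "des [] = 0"
  by (simp add: des_def)

lemma des_singleton [simp]: "des [x] = 0"
  by (simp add: des_def)

lemma des_Cons_Cons: "des (x # y # zs) = (if x > y then 1 else 0) + des (y # zs)"
proof -
  let ?D = "\<lambda>xs. {i. Suc i < length xs \<and> xs ! i > xs ! Suc i}"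
  have fin: "finite (?D xs)" for xs :: "nat list"
    by (rule finite_subset[of _ "{..<length xs}"]) auto
  have "?D (x # y # zs) = (if x > y then {0} else {}) \<union> Suc ` ?D (y # zs)"
  proof (rule set_eqI)
    fix i
    show "i \<in> ?D (x # y # zs) \<longleftrightarrow> i \<in> (if x > y then {0} else {}) \<union> Suc ` ?D (y # zs)"
      by (cases i) auto
  qed
  then have "card (?D (x # y # zs)) = card (if x > y then {0::nat} else {}) + card (Suc ` ?D (y # zs))"
    using fin by (simp only:) (intro card_Un_disjoint, auto)
  also have "card (Suc ` ?D (y # zs)) = card (?D (y # zs))"
    by (rule card_image) simp
  finally show ?thesis by (simp add: des_def)
qed

lemma des_append:
  "xs \<noteq> [] \<Longrightarrow> des (xs @ y # ys) = des xs + (if last xs > y then 1 else 0) + des (y # ys)"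
proof (induction xs)
  case (Cons x xs)
  then show ?case by (cases xs) (auto simp: des_Cons_Cons)
qed simp

lemma des_Cons_least: "\<forall>y \<in> set ys. x \<le> y \<Longrightarrow> des (x # ys) = des ys"
  by (cases ys) (auto simp: des_Cons_Cons)

lemma des_map:
  "(\<And>x y. x \<in> set xs \<Longrightarrow> y \<in> set xs \<Longrightarrow> f x > f y \<longleftrightarrow> x > y) \<Longrightarrow> des (map f xs) = des xs"
proof (induction xs)
  case (Cons x xs)
  then show ?case by (cases xs) (auto simp: des_Cons_Cons)
qed simp

text \<open>A descent of the inverse at \<open>v\<close> means that \<open>v + 1\<close> has a
  smaller position than \<open>v\<close>, so \<open>ides\<close> can be read off
  \<open>before\<close> without inverting.\<close>

lemma ides_eq:
  assumes "distinct \<pi>" "set \<pi> = {1..n}"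
  shows "ides \<pi> = card {v. before \<pi> (Suc v) v}"
proof -
  have len: "length \<pi> = n" using assms distinct_card[of \<pi>] by simp
  \<comment> \<open>The 0-based position of a letter; as each letter occurs once, the
    \<open>LEAST\<close> is its only occurrence.\<close>
  define p where "p v = (LEAST i. i < length \<pi> \<and> \<pi> ! i = v)" for v
  have p: "p v < n \<and> \<pi> ! p v = v" if "v \<in> {1..n}" for v
  proof -
    have "\<exists>i. i < length \<pi> \<and> \<pi> ! i = v" using that assms by (metis in_set_conv_nth)
    from LeastI_ex[OF this] show ?thesis by (simp add: p_def len)
  qed
  have p_nth: "p (\<pi> ! i) = i" if "i < n" for i
    using p[of "\<pi> ! i"] that assms len nth_eq_iff_index_eq[OF assms(1)] nth_mem[of i \<pi>] by auto
  have before: "before \<pi> u v \<longleftrightarrow> u \<in> {1..n} \<and> v \<in> {1..n} \<and> p u < p v" for u v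
  proof
    assume b: "before \<pi> u v"
    then obtain i j where "i < j" "j < n" "\<pi> ! i = u" "\<pi> ! j = v"
      by (auto simp: before_iff_nth len)
    then show "u \<in> {1..n} \<and> v \<in> {1..n} \<and> p u < p v"
      using before_in_set[OF b] p_nth[of i] p_nth[of j] assms by auto
  next
    assume "u \<in> {1..n} \<and> v \<in> {1..n} \<and> p u < p v"
    then show "before \<pi> u v" using p[of u] p[of v] by (auto simp: before_iff_nth len)
  qed
  have nth: "inv_perm \<pi> ! i = Suc (p (Suc i))" if "i < n" for i
    using that by (simp add: inv_perm_def p_def len del: upt_Suc)
  \<comment> \<open>List index \<open>i\<close> of the inverse belongs to the value
    \<open>i + 1\<close>, hence the image under \<open>Suc\<close>.\<close>
  have "{v. before \<pi> (Suc v) v} = Suc ` {i. Suc i < n \<and> p (Suc (Suc i)) < p (Suc i)}"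
  proof (rule set_eqI)
    fix v
    show "v \<in> {v. before \<pi> (Suc v) v} \<longleftrightarrow> v \<in> Suc ` {i. Suc i < n \<and> p (Suc (Suc i)) < p (Suc i)}"
      by (cases v) (auto simp: before)
  qed
  also have "{i. Suc i < n \<and> p (Suc (Suc i)) < p (Suc i)} =
      {i. Suc i < length (inv_perm \<pi>) \<and> inv_perm \<pi> ! i > inv_perm \<pi> ! Suc i}"
  proof -
    have "length (inv_perm \<pi>) = n" by (simp add: inv_perm_def len)
    then show ?thesis using nth by (auto simp: Suc_lessD)
  qed
  finally show ?thesis by (simp add: ides_def des_def card_image)
qed

lemma ides_avoiders: "\<pi> \<in> avoiders n \<Longrightarrow> ides \<pi> = card {v. before \<pi> (Suc v) v}"
  using ides_eq by (auto simp: avoiders_iff)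

lemma finite_before: "finite {v. before xs (Suc v) v}"
  by (rule finite_subset[of _ "set xs"]) (auto dest: before_in_set)

section \<open>Avoiders that begin with 1\<close>

text \<open>A leading 1 takes part in no forbidden quadruple: the first letter could only play 2 or
  4, and both need a smaller letter later. It also precedes 2, so it creates neither a descent nor
  an inverse descent.\<close>

lemma Cons_1_avoiders:
  assumes "\<beta> \<in> avoiders n"
  shows "1 # map Suc \<beta> \<in> avoiders (Suc n)"
    and "des (1 # map Suc \<beta>) = des \<beta>"
    and "ides (1 # map Suc \<beta>) = ides \<beta>"
proof -
  have \<beta>: "distinct \<beta>" "set \<beta> = {1..n}" "avoids \<beta>" using assms by (auto simp: avoiders_iff)
  have "avoids (1 # map Suc \<beta>)"
    using \<beta> unfolding avoids_def by (auto simp: before_map dest: before_in_set)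
  then show mem: "1 # map Suc \<beta> \<in> avoiders (Suc n)"
    using \<beta> by (auto simp: avoiders_iff distinct_map image_Suc_atLeastAtMost)
  show "des (1 # map Suc \<beta>) = des \<beta>"
    by (subst des_Cons_least) (auto intro: des_map)
  have "{v. before (1 # map Suc \<beta>) (Suc v) v} = Suc ` {v. before \<beta> (Suc v) v}"
    using before_in_set[of \<beta>] \<beta>(2) by (fastforce simp: before_map)
  then show "ides (1 # map Suc \<beta>) = ides \<beta>"
    unfolding ides_avoiders[OF mem] ides_avoiders[OF assms] by (simp only: card_image inj_Suc)
qed

lemma Cons_1_avoidersE:
  assumes "1 # xs \<in> avoiders (Suc n)"
  obtains \<beta> where "\<beta> \<in> avoiders n" "xs = map Suc \<beta>"
proof -
  have xs: "distinct xs" "1 \<notin> set xs" "insert 1 (set xs) = {1..Suc n}" "avoids (1 # xs)"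
    using assms by (auto simp: avoiders_iff)
  then have "set xs = {1..Suc n} - {1}" by (metis Diff_insert_absorb)
  also have "\<dots> = {2..Suc n}" by auto
  finally have set_xs: "set xs = {2..Suc n}" .
  define \<beta> where "\<beta> = map (\<lambda>x. x - 1) xs"
  have eq: "xs = map Suc \<beta>"
    unfolding \<beta>_def map_map using set_xs by (intro map_idI[symmetric]) auto
  have "Suc ` set \<beta> = Suc ` {1..n}"
    using set_xs by (simp add: eq image_Suc_atLeastAtMost numeral_2_eq_2)
  then have "set \<beta> = {1..n}" by (metis inj_Suc inj_image_eq_iff)
  moreover have "avoids \<beta>"
    by (rule avoids_embedding[OF xs(4), of _ Suc]) (auto simp: eq before_map)
  ultimately have "\<beta> \<in> avoiders n"
    using xs(1) by (simp add: avoiders_iff eq distinct_map)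
  with eq that show thesis by blast
qed

section \<open>Inflating the first letter of an avoider\<close>

text \<open>Replaces the first letter of \<open>\<sigma>\<close> by a copy of \<open>\<alpha>\<close> and inserts a new smallest letter right after it.\<close>

definition inflate :: "nat list \<Rightarrow> nat list \<Rightarrow> nat list" where
  "inflate \<alpha> \<sigma> = map (\<lambda>x. x + hd \<sigma>) \<alpha> @
     1 # map (\<lambda>x. if x < hd \<sigma> then Suc x else x + length \<alpha>) (tl \<sigma>)"

text \<open>With \<open>k = length \<alpha>\<close>, the letters of \<open>\<tau>\<close> below
  \<open>a\<close> move to \<open>2..a\<close>, the block fills \<open>a + 1..a + k\<close>, and the
  letters above \<open>a\<close> move past \<open>a + k\<close>. After distinctness, inclusion and a
  count of letters give the set.\<close>

lemma inflate_perm: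
  assumes \<alpha>: "distinct \<alpha>" "set \<alpha> = {1..k}" and \<sigma>: "distinct (a # \<tau>)" "set (a # \<tau>) = {1..m}"
  shows "distinct (inflate \<alpha> (a # \<tau>)) \<and> set (inflate \<alpha> (a # \<tau>)) = {1..k + m}"
proof -
  have k: "length \<alpha> = k" using distinct_card[OF \<alpha>(1)] \<alpha>(2) by simp
  have a: "a \<in> {1..m}" and \<tau>: "set \<tau> = {1..m} - {a}" "distinct \<tau>" using \<sigma> by auto
  have "inj_on (\<lambda>x. if x < a then Suc x else x + length \<alpha>) (set \<tau>)"
    by (auto simp: inj_on_def \<tau> split: if_splits)
  then have d: "distinct (inflate \<alpha> (a # \<tau>))"
    using \<alpha> a \<tau> by (auto simp: inflate_def distinct_map k[symmetric])
  have "set (inflate \<alpha> (a # \<tau>)) \<subseteq> {1..k + m}"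
    using a by (auto simp: inflate_def k \<alpha> \<tau>)
  moreover have "card (set (inflate \<alpha> (a # \<tau>))) = k + m"
    using distinct_card[OF d] distinct_card[OF \<sigma>(1)] \<sigma>(2) by (simp add: inflate_def k)
  ultimately have "set (inflate \<alpha> (a # \<tau>)) = {1..k + m}"
    by (intro card_subset_eq) auto
  with d show ?thesis ..
qed

text \<open>Both \<open>\<alpha>\<close> and \<open>a # \<tau>\<close> embed in the inflation.
  Conversely, the block is an interval of values standing first, so a forbidden quadruple lies
  inside it or uses at most one of its letters, which \<open>a\<close> can replace.\<close>

lemma avoids_inflate:
  assumes \<alpha>: "distinct \<alpha>" "set \<alpha> = {1..k}" "\<alpha> \<noteq> []"
    and \<sigma>: "distinct (a # \<tau>)" "set (a # \<tau>) = {1..m}"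
  shows "avoids (inflate \<alpha> (a # \<tau>)) \<longleftrightarrow> avoids \<alpha> \<and> avoids (a # \<tau>)"
proof -
  have k: "length \<alpha> = k" using distinct_card[OF \<alpha>(1)] \<alpha>(2) by simp
  have a: "a \<in> {1..m}" and \<tau>: "set \<tau> = {1..m} - {a}" "distinct \<tau>" using \<sigma> by auto
  define g where "g x = (if x < a then Suc x else x + k)" for x
  define \<pi> where "\<pi> = inflate \<alpha> (a # \<tau>)"
  have \<pi>: "\<pi> = map (\<lambda>x. x + a) \<alpha> @ 1 # map g \<tau>"
    by (simp add: \<pi>_def inflate_def g_def k)
  have bef: "before \<pi> u v \<longleftrightarrow> (\<exists>x y. before \<alpha> x y \<and> u = x + a \<and> v = y + a)
      \<or> (\<exists>x y. before \<tau> x y \<and> u = g x \<and> v = g y)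
      \<or> (\<exists>x\<in>set \<alpha>. u = x + a) \<and> (v = 1 \<or> (\<exists>y\<in>set \<tau>. v = g y))
      \<or> u = 1 \<and> (\<exists>y\<in>set \<tau>. v = g y)" for u v
    by (auto simp: \<pi> before_append before_map)
  have inA: "x + a \<in> {a<..a+k}" if "x \<in> set \<alpha>" for x
    using that \<alpha> by auto
  have inB: "g x > 1" "g x \<le> a \<and> x < a \<and> g x = Suc x \<or> g x > a + k \<and> x > a \<and> g x = x + k"
    if "x \<in> set \<tau>" for x
  proof -
    have "x \<ge> 1" "x < a \<or> x > a" using that unfolding \<tau>(1) by auto
    then show "g x > 1" "g x \<le> a \<and> x < a \<and> g x = Suc x \<or> g x > a + k \<and> x > a \<and> g x = x + k"
      using a by (auto simp: g_def)
  qed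
  have g_mono: "g x < g y \<longleftrightarrow> x < y" if "x \<in> set \<tau>" "y \<in> set \<tau>" for x y
    using inB(2)[OF that(1)] inB(2)[OF that(2)] by linarith
  have "avoids \<alpha>" if "avoids \<pi>"
    by (rule avoids_embedding[OF that, of _ "\<lambda>x. x + a"]) (auto simp: bef)
  \<comment> \<open>The contracted letter \<open>a\<close> is represented by the first letter of the
    block.\<close>
  moreover have "avoids (a # \<tau>)" if "avoids \<pi>"
  proof (rule avoids_embedding[OF that, of _ "\<lambda>x. if x = a then hd \<alpha> + a else g x"])
    have hd: "hd \<alpha> \<in> set \<alpha>" using \<alpha>(3) by simp
    show "before \<pi> (if x = a then hd \<alpha> + a else g x) (if y = a then hd \<alpha> + a else g y)"
      if "before (a # \<tau>) x y" for x y
      using that hd \<tau> by (auto simp: bef dest: before_in_set)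
    show "(if x = a then hd \<alpha> + a else g x) < (if y = a then hd \<alpha> + a else g y)"
      if "x \<in> set (a # \<tau>)" "y \<in> set (a # \<tau>)" "x < y" for x y
      using that inB[of x] inB[of y] inA[OF hd] g_mono[of x y] by auto
  qed
  moreover have "avoids \<pi>" if av: "avoids \<alpha>" "avoids (a # \<tau>)"
    unfolding avoids_def
  proof (intro allI impI notI)
    fix p1 p2 p3 p4
    assume b: "before \<pi> p2 p1" "before \<pi> p4 p1" "before \<pi> p1 p3"
      and less: "p1 < p2 \<and> p2 < p3 \<and> p3 < p4"
    have "p3 \<noteq> 1" using less by auto
    have not_between: "\<not> (x + a < g y \<and> g y < z + a)" if "x \<in> set \<alpha>" "z \<in> set \<alpha>" "y \<in> set \<tau>" for x y z
      using inA[OF that(1)] inA[OF that(2)] inB[OF that(3)] by auto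
    have disj: "x + a \<noteq> g y" "x + a \<noteq> 1" "g y \<noteq> 1" if "x \<in> set \<alpha>" "y \<in> set \<tau>" for x y
      using inA[OF that(1)] inB[OF that(2)] a by auto
    have disj1: "x + a \<noteq> 1" if "x \<in> set \<alpha>" for x
      using inA[OF that(1)] a by auto
    \<comment> \<open>Split by the places of \<open>p1\<close> and \<open>p3\<close>, the letters
      playing 1 and 3. If \<open>p1\<close> is in the block or is the letter 1, then
      \<open>p2\<close> and \<open>p4\<close> are block letters; a \<open>p3\<close> outside the
      block would then split the interval.\<close>
    consider (A) x1 x3 where "before \<alpha> x1 x3" "p1 = x1 + a" "p3 = x3 + a"
      | (AB) x1 y3 where "x1 \<in> set \<alpha>" "p1 = x1 + a" "y3 \<in> set \<tau>" "p3 = g y3"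
      | (1) y3 where "p1 = 1" "y3 \<in> set \<tau>" "p3 = g y3"
      | (B) y1 y3 where "before \<tau> y1 y3" "p1 = g y1" "p3 = g y3"
      using b(3) \<open>p3 \<noteq> 1\<close> unfolding bef by blast
    then show False
    proof cases
      case A
      have *: "\<exists>x. before \<alpha> x x1 \<and> p = x + a" if "before \<pi> p p1" for p
        using that A disj disj1 before_in_set[OF A(1)] before_in_set[of \<tau>] unfolding bef by fastforce
      show False using *[OF b(1)] *[OF b(2)] A av(1) less unfolding avoids_def by auto
    next
      case AB
      have *: "\<exists>x\<in>set \<alpha>. p = x + a" if "before \<pi> p p1" for p
        using that AB disj disj1 before_in_set[of \<tau>] before_in_set[of \<alpha>] unfolding bef by fastforce
      show False using *[OF b(1)] *[OF b(2)] AB less not_between by blast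
    next
      case 1
      have *: "\<exists>x\<in>set \<alpha>. p = x + a" if "before \<pi> p p1" for p
        using that 1 disj disj1 before_in_set[of \<tau>] before_in_set[of \<alpha>] inB(1) unfolding bef by fastforce
      show False using *[OF b(1)] *[OF b(2)] 1 less not_between by blast
    next
      case B
      have y: "y1 \<in> set \<tau>" "y3 \<in> set \<tau>" using before_in_set[OF B(1)] by auto
      have inj: "z = y1" if "z \<in> set \<tau>" "g z = g y1" for z
        using that g_mono y by (metis less_irrefl linorder_neqE_nat)
      have *: "(\<exists>x\<in>set \<alpha>. p = x + a) \<or> (\<exists>x. before \<tau> x y1 \<and> p = g x)"
        if bp: "before \<pi> p p1" "p > p1" for p
      proof -
        have "p \<noteq> 1" using bp B inB(1)[OF y(1)] by auto
        then consider x y where "before \<alpha> x y" "p1 = y + a"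
          | x y where "before \<tau> x y" "p = g x" "p1 = g y" | "\<exists>x\<in>set \<alpha>. p = x + a"
          using bp(1) unfolding bef by blast
        then show ?thesis
        proof cases
          case (1 x y)
          then show ?thesis using disj(1)[of y y1] before_in_set[of \<alpha> x y] y(1) B(2) by auto
        next
          case (2 x y)
          then have "y = y1" using inj before_in_set[of \<tau> x y] B(2) by auto
          then show ?thesis using 2 by blast
        qed blast
      qed
      have before_a: "before (a # \<tau>) a y1" "before (a # \<tau>) y1 y3" using y B by auto
      have sep: "x + a < g z \<longleftrightarrow> a < z" "g z < x + a \<longleftrightarrow> z < a" if "x \<in> set \<alpha>" "z \<in> set \<tau>" for x z
        using inA[OF that(1)] inB[OF that(2)] by auto
      \<comment> \<open>Now \<open>p1\<close> and \<open>p3\<close> come after the letter 1. Not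
        both of \<open>p2\<close> and \<open>p4\<close> are in the block, since \<open>p3\<close>
        lies between them; a single one there is replaced by \<open>a\<close>.\<close>
      consider x2 x4 where "x2 \<in> set \<alpha>" "p2 = x2 + a" "x4 \<in> set \<alpha>" "p4 = x4 + a"
        | x2 y4 where "x2 \<in> set \<alpha>" "p2 = x2 + a" "before \<tau> y4 y1" "p4 = g y4"
        | y2 x4 where "before \<tau> y2 y1" "p2 = g y2" "x4 \<in> set \<alpha>" "p4 = x4 + a"
        | y2 y4 where "before \<tau> y2 y1" "p2 = g y2" "before \<tau> y4 y1" "p4 = g y4"
        using *[OF b(1)] *[OF b(2)] less by fastforce
      then show False
      proof cases
        case 1
        then show False using not_between y B less by blast
      next
        case 2
        then have "before (a # \<tau>) y4 y1" "y1 < a" "a < y3" "y3 < y4"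
          using less B y sep g_mono before_in_set[of \<tau>] by auto
        then show False using av(2) before_a unfolding avoids_def by blast
      next
        case 3
        then have "before (a # \<tau>) y2 y1" "y1 < y2" "y2 < y3" "y3 < a"
          using less B y sep g_mono before_in_set[of \<tau>] by auto
        then show False using av(2) before_a unfolding avoids_def by blast
      next
        case 4
        then have "before (a # \<tau>) y2 y1" "before (a # \<tau>) y4 y1" "y1 < y2" "y2 < y3" "y3 < y4"
          using less B y g_mono before_in_set[of \<tau>] by auto
        then show False using av(2) before_a unfolding avoids_def by blast
      qed
    qed
  qed
  ultimately show ?thesis unfolding \<pi>_def by blast
qed

text \<open>The letter 1 is the bottom of a descent exactly when something precedes it, and it
  starts no descent. Allowing \<open>xs = []\<close> covers the tail of an inflated one-letter
  block.\<close>

lemma des_shift_append: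
  assumes "a \<ge> 1" "\<forall>x\<in>set xs. x \<ge> 1" "\<forall>x\<in>set \<tau>. g x \<ge> 1"
    and "\<And>x y. x \<in> set \<tau> \<Longrightarrow> y \<in> set \<tau> \<Longrightarrow> g x > g y \<longleftrightarrow> x > y"
  shows "des (map (\<lambda>x. x + a) xs @ 1 # map g \<tau>) = des xs + (if xs = [] then 0 else 1) + des \<tau>"
proof -
  have \<tau>: "des (1 # map g \<tau>) = des \<tau>"
    using assms(3,4) by (subst des_Cons_least) (auto intro: des_map)
  show ?thesis
  proof (cases "xs = []")
    case False
    then have "last xs + a > 1" using assms(1,2) last_in_set[OF False] by fastforce
    moreover have "des (map (\<lambda>x. x + a) xs) = des xs" by (rule des_map) auto
    ultimately show ?thesis using False \<tau> by (simp add: des_append last_map)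
  qed (use \<tau> in simp)
qed

lemma des_inflate:
  assumes \<alpha>: "distinct \<alpha>" "set \<alpha> = {1..k}" "\<alpha> \<noteq> []"
    and \<sigma>: "distinct (a # \<tau>)" "set (a # \<tau>) = {1..m}"
  shows "des (inflate \<alpha> (a # \<tau>)) = des \<alpha> + 1 + des \<tau>"
    and "des (tl (inflate \<alpha> (a # \<tau>))) = des (tl \<alpha>) + (if tl \<alpha> = [] then 0 else 1) + des \<tau>"
proof -
  have a: "a \<ge> 1" and \<tau>: "set \<tau> = {1..m} - {a}" using \<sigma> by auto
  define g where "g x = (if x < a then Suc x else x + length \<alpha>)" for x
  have g: "g x \<ge> 1" if "x \<in> set \<tau>" for x
    using that unfolding \<tau> by (auto simp: g_def)
  have mono: "g x > g y \<longleftrightarrow> x > y" if "x \<in> set \<tau>" "y \<in> set \<tau>" for x y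
    using that unfolding \<tau> by (auto simp: g_def)
  have pos: "\<forall>x\<in>set \<alpha>. x \<ge> 1" "\<forall>x\<in>set (tl \<alpha>). x \<ge> 1"
    using \<alpha>(2,3) list.set_sel(2)[of \<alpha>] by auto
  have eq: "inflate \<alpha> (a # \<tau>) = map (\<lambda>x. x + a) \<alpha> @ 1 # map g \<tau>"
    by (simp add: inflate_def g_def)
  show "des (inflate \<alpha> (a # \<tau>)) = des \<alpha> + 1 + des \<tau>"
    unfolding eq using \<alpha>(3) by (subst des_shift_append) (use a pos g mono in auto)
  have "tl (inflate \<alpha> (a # \<tau>)) = map (\<lambda>x. x + a) (tl \<alpha>) @ 1 # map g \<tau>"
    using \<alpha>(3) by (simp add: eq map_tl)
  then show "des (tl (inflate \<alpha> (a # \<tau>))) = des (tl \<alpha>) + (if tl \<alpha> = [] then 0 else 1) + des \<tau>"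
    by (simp only:) (rule des_shift_append, use a pos g mono in auto)
qed

text \<open>Consecutive values inside the block give \<open>ides \<alpha>\<close>. The others match
  those of \<open>a # \<tau>\<close>, the block acting as \<open>a\<close>: its bottom value
  precedes the value just below, and its top value precedes the value just above. The new pair 1, 2
  counts exactly when 2 lies in the block, that is, when \<open>a = 1\<close>.\<close>

lemma ides_inflate:
  assumes \<alpha>: "distinct \<alpha>" "set \<alpha> = {1..k}" "\<alpha> \<noteq> []"
    and \<sigma>: "distinct (a # \<tau>)" "set (a # \<tau>) = {1..m}"
  shows "ides (inflate \<alpha> (a # \<tau>)) = ides \<alpha> + ides (a # \<tau>) + (if a = 1 then 1 else 0)"
proof -
  have k: "length \<alpha> = k" using distinct_card[OF \<alpha>(1)] \<alpha>(2) by simp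
  then have "k \<ge> 1" using \<alpha>(3) by (cases \<alpha>) auto
  have a: "a \<ge> 1" "a \<le> m" and \<tau>: "set \<tau> = {1..m} - {a}" "distinct \<tau>" using \<sigma> by auto
  define g where "g x = (if x < a then Suc x else x + k)" for x
  define \<pi> where "\<pi> = inflate \<alpha> (a # \<tau>)"
  have \<pi>: "\<pi> = map (\<lambda>x. x + a) \<alpha> @ 1 # map g \<tau>"
    by (simp add: \<pi>_def inflate_def g_def k)
  have bef: "before \<pi> u v \<longleftrightarrow> (\<exists>x y. before \<alpha> x y \<and> u = x + a \<and> v = y + a)
      \<or> (\<exists>x y. before \<tau> x y \<and> u = g x \<and> v = g y)
      \<or> (\<exists>x\<in>set \<alpha>. u = x + a) \<and> (v = 1 \<or> (\<exists>y\<in>set \<tau>. v = g y))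
      \<or> u = 1 \<and> (\<exists>y\<in>set \<tau>. v = g y)" for u v
    by (auto simp: \<pi> before_append before_map)
  have inB: "x \<ge> 1 \<and> (g x \<le> a \<and> x < a \<and> g x = Suc x \<or> g x > a + k \<and> x > a \<and> g x = x + k)"
    if "x \<in> set \<tau>" for x
  proof -
    have "x \<ge> 1" "x < a \<or> x > a" using that unfolding \<tau>(1) by auto
    then show ?thesis by (auto simp: g_def)
  qed
  let ?I = "\<lambda>xs. {v. before xs (Suc v) v}"
  have I\<alpha>: "v \<ge> 1 \<and> v < k" if "v \<in> ?I \<alpha>" for v
    using that before_in_set[of \<alpha> "Suc v" v] \<alpha>(2) by auto
  have I\<sigma>: "v \<ge> 1 \<and> (v < a \<and> g v = Suc v \<or> v > a \<and> g v = v + k)" if "v \<in> ?I (a # \<tau>)" for v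
  proof -
    have "v \<in> set \<tau>" using that by (auto dest: before_in_set)
    then show ?thesis using inB[of v] by auto
  qed
  have "?I \<pi> = (\<lambda>v. v + a) ` ?I \<alpha> \<union> (g ` ?I (a # \<tau>) \<union> (if a = 1 then {1} else {}))" (is "_ = ?R")
  proof (intro equalityI subsetI)
    fix v assume "v \<in> ?I \<pi>"
    then consider (A) x y where "before \<alpha> x y" "Suc v = x + a" "v = y + a"
      | (B) x y where "before \<tau> x y" "Suc v = g x" "v = g y"
      | (1) x where "x \<in> set \<alpha>" "Suc v = x + a" "v = 1"
      | (AB) x y where "x \<in> set \<alpha>" "Suc v = x + a" "y \<in> set \<tau>" "v = g y"
      | (0) "Suc v = 1" "\<exists>y\<in>set \<tau>. v = g y"
      unfolding mem_Collect_eq bef by blast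
    then show "v \<in> ?R"
    proof cases
      case A
      then have "y \<in> ?I \<alpha>" by auto
      then show ?thesis using A by auto
    next
      case B
      have "x \<in> set \<tau>" "y \<in> set \<tau>" using before_in_set[OF B(1)] by auto
      \<comment> \<open>Images from opposite sides of the block differ by more than
        \<open>k \<ge> 1\<close>, so consecutive ones come from the same side.\<close>
      then have "x = Suc y" using inB[of x] inB[of y] B(2,3) \<open>k \<ge> 1\<close> by linarith
      then have "y \<in> ?I (a # \<tau>)" using B by auto
      then show ?thesis using B by blast
    next
      case 1
      have "x \<ge> 1" using 1(1) \<alpha>(2) by auto
      then have "a = 1" using 1 a by linarith
      then show ?thesis using 1 by simp
    next
      case AB
      \<comment> \<open>Here \<open>v + 1\<close> is in the block and \<open>v\<close> is not, so
        \<open>v = a\<close>, the image of \<open>a - 1\<close>.\<close>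
      have "x \<ge> 1" "x \<le> k" using AB(1) \<alpha>(2) by auto
      then have "a = Suc y" using AB inB[of y] by linarith
      then have "y \<in> ?I (a # \<tau>)" using AB by auto
      then show ?thesis using AB by blast
    next
      case 0
      then show ?thesis using inB a by fastforce
    qed
  next
    fix v assume "v \<in> ?R"
    then consider (A) w where "w \<in> ?I \<alpha>" "v = w + a"
      | (B) w where "w \<in> ?I (a # \<tau>)" "v = g w" | (1) "a = 1" "v = 1"
      by (auto split: if_splits)
    then show "v \<in> ?I \<pi>"
    proof cases
      case A
      then have "before \<pi> (Suc w + a) (w + a)" using bef by blast
      then show ?thesis using A by simp
    next
      case B
      then consider "Suc w = a" "w \<in> set \<tau>" | "before \<tau> (Suc w) w" by auto
      then show ?thesis
      proof cases
        case 1
        \<comment> \<open>The letter 1 of \<open>\<alpha>\<close> becomes the bottom value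
          \<open>a + 1\<close> of the block.\<close>
        have "1 \<in> set \<alpha>" using \<alpha>(2) \<open>k \<ge> 1\<close> by simp
        then have "before \<pi> (1 + a) (g w)" using bef 1(2) by blast
        then show ?thesis using B(2) 1(1) by (auto simp: g_def)
      next
        case 2
        have *: "Suc w \<in> set \<tau>" "w \<in> set \<tau>" using before_in_set[OF 2] by auto
        have "g (Suc w) = Suc (g w)" using inB[OF *(1)] inB[OF *(2)] by linarith
        moreover have "before \<pi> (g (Suc w)) (g w)" using bef 2 by blast
        ultimately show ?thesis using B(2) by simp
      qed
    next
      case 1
      have "1 \<in> set \<alpha>" using \<alpha>(2) \<open>k \<ge> 1\<close> by simp
      then have "before \<pi> (1 + a) 1" using bef by blast
      then show ?thesis using 1 by simp
    qed
  qed
  moreover have "(\<lambda>v. v + a) ` ?I \<alpha> \<inter> (g ` ?I (a # \<tau>) \<union> (if a = 1 then {1} else {})) = {}"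
    using I\<alpha> I\<sigma> by (fastforce split: if_splits)
  moreover have "g ` ?I (a # \<tau>) \<inter> (if a = 1 then {1} else {}) = {}"
    using I\<sigma> by (fastforce split: if_splits)
  moreover have "inj_on g (?I (a # \<tau>))"
    by (rule inj_onI) (use I\<sigma> in \<open>smt (verit) Suc_inject add_right_cancel less_trans_Suc trans_less_add1 less_irrefl leD Suc_leI\<close>)
  moreover have "finite (?I \<alpha>)" "finite (?I (a # \<tau>))" by (rule finite_before)+
  ultimately have "card (?I \<pi>) = card (?I \<alpha>) + (card (?I (a # \<tau>)) + card (if a = 1 then {1::nat} else {}))"
    by (simp only:) (subst card_Un_disjoint, simp, simp, simp, subst card_Un_disjoint, simp, simp, simp, simp add: card_image)
  moreover have "card (if a = 1 then {1::nat} else {}) = (if a = 1 then 1 else 0)" by simp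
  moreover have "ides \<pi> = card (?I \<pi>)"
    using inflate_perm[OF \<alpha>(1,2) \<sigma>] ides_eq unfolding \<pi>_def by blast
  ultimately show ?thesis
    unfolding \<pi>_def[symmetric] by (simp only: ides_eq[OF \<alpha>(1,2)] ides_eq[OF \<sigma>] add.assoc)
qed

section \<open>Unique decomposition at the letter 1\<close>

text \<open>Since 1 can play the smallest letter of both patterns, no letter after 1 lies strictly between
  two letters before it; hence the letters before 1 form an interval of values.\<close>

lemma inflateE:
  assumes \<pi>: "\<pi> \<in> avoiders n" "\<pi> = A @ 1 # B" "A \<noteq> []"
  obtains k \<alpha> \<sigma> where "k \<in> {1..<n}" "\<alpha> \<in> avoiders k" "\<sigma> \<in> avoiders (n - k)" "\<pi> = inflate \<alpha> \<sigma>"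
proof -
  have dist: "distinct A" "distinct B" "1 \<notin> set A" "1 \<notin> set B" "set A \<inter> set B = {}"
    and set_\<pi>: "set A \<union> {1} \<union> set B = {1..n}" and av: "avoids (A @ 1 # B)"
    using \<pi> by (auto simp: avoiders_iff)
  have len: "length A + 1 + length B = n" using length_avoiders[OF \<pi>(1)] \<pi>(2) by simp
  have sep: "\<not> (b < c \<and> c < d)" if "b \<in> set A" "d \<in> set A" "c \<in> set B" for b c d
  proof -
    have "b \<in> {1..n}" "b \<noteq> 1" using that(1) dist set_\<pi> by blast+
    then have "1 < b" by auto
    moreover have "before (A @ 1 # B) b 1" "before (A @ 1 # B) d 1" "before (A @ 1 # B) 1 c"
      using that by (auto simp: before_append)
    ultimately show ?thesis using av unfolding avoids_def by blast
  qed
  define lo hi where "lo = Min (set A)" and "hi = Max (set A)"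
  have lo: "lo \<in> set A" "\<And>x. x \<in> set A \<Longrightarrow> lo \<le> x" and hi: "hi \<in> set A" "\<And>x. x \<in> set A \<Longrightarrow> x \<le> hi"
    using \<pi>(3) by (auto simp: lo_def hi_def)
  have bnd: "lo \<in> {1..n}" "lo \<noteq> 1" "hi \<in> {1..n}" using lo(1) hi(1) dist set_\<pi> by blast+
  have A: "set A = {lo..hi}"
  proof (intro equalityI subsetI)
    fix v assume v: "v \<in> {lo..hi}"
    then have "v \<in> {1..n}" "v \<noteq> 1" using bnd by auto
    then have "v \<in> set A \<or> v \<in> set B" using set_\<pi> by blast
    moreover have "v \<notin> set B"
    proof
      assume "v \<in> set B"
      then have "v \<noteq> lo" "v \<noteq> hi" using lo(1) hi(1) dist by auto
      then show False using sep[OF lo(1) hi(1) \<open>v \<in> set B\<close>] v by auto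
    qed
    ultimately show "v \<in> set A" by blast
  qed (use lo(2) hi(2) in auto)
  \<comment> \<open>The contracted block has value \<open>lo - 1\<close>, since deleting the letter
    1 lowers everything above it by one; it is positive because \<open>lo\<close> is not 1.\<close>
  define a k where "a = lo - 1" and "k = length A"
  have a: "a \<ge> 1" "lo = Suc a" using bnd by (auto simp: a_def)
  have "k = Suc hi - lo" using distinct_card[OF dist(1)] A by (simp add: k_def)
  then have hi_eq: "hi = a + k" using lo(2)[OF hi(1)] a by simp
  have k: "k \<ge> 1" "k < n" using \<pi>(3) len by (auto simp: k_def Suc_le_eq)
  have B: "x \<ge> 2 \<and> x \<le> n \<and> (x \<le> a \<or> x > a + k)" if "x \<in> set B" for x
  proof -
    have "x \<in> {1..n}" "x \<noteq> 1" "x \<notin> {lo..hi}" using that dist set_\<pi> A by blast+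
    then show ?thesis using a hi_eq by auto
  qed
  define \<alpha> where "\<alpha> = map (\<lambda>x. x - a) A"
  \<comment> \<open>Inverse of the relabelling of \<open>\<tau>\<close> in
    \<open>inflate\<close>.\<close>
  define h where "h x = (if x \<le> a then x - 1 else x - k)" for x
  have h: "h x \<ge> 1 \<and> h x \<le> n - k \<and> (x \<le> a \<and> h x < a \<and> x = Suc (h x) \<or> h x > a \<and> x = h x + k)"
    if "x \<in> set B" for x
    using B[OF that] bnd hi_eq by (auto simp: h_def)
  have \<alpha>: "distinct \<alpha>" "set \<alpha> = {1..k}" "\<alpha> \<noteq> []"
  proof -
    have "inj_on (\<lambda>x. x - a) (set A)" using A a by (auto simp: inj_on_def)
    then show "distinct \<alpha>" using dist by (simp add: \<alpha>_def distinct_map)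
    have "set \<alpha> = (\<lambda>x. x - a) ` {Suc a..a + k}" using A a hi_eq by (simp add: \<alpha>_def)
    also have "\<dots> = {1..k}"
    proof (intro equalityI subsetI)
      fix v assume "v \<in> {1..k}"
      then show "v \<in> (\<lambda>x. x - a) ` {Suc a..a + k}" by (intro image_eqI[of _ _ "v + a"]) auto
    qed auto
    finally show "set \<alpha> = {1..k}" .
    show "\<alpha> \<noteq> []" using \<pi>(3) by (simp add: \<alpha>_def)
  qed
  define \<tau> where "\<tau> = map h B"
  have inj: "inj_on h (set B)"
  proof (rule inj_onI)
    fix x y assume "x \<in> set B" "y \<in> set B" "h x = h y"
    then show "x = y" using h[of x] h[of y] by linarith
  qed
  \<comment> \<open>Letters of \<open>B\<close> below the block land below \<open>a\<close>, those
    above it land above \<open>a\<close>, leaving \<open>a\<close> free for the contracted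
    block.\<close>
  have "a \<notin> h ` set B" using h by fastforce
  then have \<sigma>1: "distinct (a # \<tau>)" using inj dist by (simp add: \<tau>_def distinct_map)
  have "a \<le> n - k" using bnd hi_eq by auto
  then have "set (a # \<tau>) \<subseteq> {1..n - k}" using a h by (auto simp: \<tau>_def)
  moreover have "card (set (a # \<tau>)) = n - k"
    using distinct_card[OF \<sigma>1] len by (simp add: \<tau>_def k_def)
  ultimately have \<sigma>2: "set (a # \<tau>) = {1..n - k}" by (intro card_subset_eq) auto
  have "map (\<lambda>x. x + a) \<alpha> = A"
    unfolding \<alpha>_def map_map using A a by (intro map_idI) auto
  moreover have "map (\<lambda>x. if x < a then Suc x else x + length \<alpha>) \<tau> = B"
  proof -
    have "length \<alpha> = k" by (simp add: \<alpha>_def k_def)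
    then show ?thesis unfolding \<tau>_def map_map by (intro map_idI) (use h in fastforce)
  qed
  ultimately have eq: "\<pi> = inflate \<alpha> (a # \<tau>)" using \<pi>(2) by (simp add: inflate_def)
  then have "avoids \<alpha>" "avoids (a # \<tau>)"
    using avoids_inflate[OF \<alpha> \<sigma>1 \<sigma>2] \<pi>(1) by (auto simp: avoiders_iff)
  then have "\<alpha> \<in> avoiders k" "a # \<tau> \<in> avoiders (n - k)"
    using \<alpha> \<sigma>1 \<sigma>2 by (auto simp: avoiders_iff)
  with that k eq show thesis by auto
qed

text \<open>The unique letter 1 separates block from rest. The block length gives \<open>k\<close>,
  its range of values gives \<open>a\<close>, and both relabellings can then be undone.\<close>

lemma inflate_inject:
  assumes \<alpha>: "\<alpha> \<in> avoiders k" "\<alpha>' \<in> avoiders k'" "k \<ge> 1" "k' \<ge> 1"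
    and \<sigma>: "\<sigma> \<in> avoiders m" "\<sigma>' \<in> avoiders m'" "m \<ge> 1" "m' \<ge> 1"
    and eq: "inflate \<alpha> \<sigma> = inflate \<alpha>' \<sigma>'"
  shows "k = k'" "\<alpha> = \<alpha>'" "\<sigma> = \<sigma>'"
proof -
  obtain a \<tau> where a: "\<sigma> = a # \<tau>" using \<sigma>(1,3) length_avoiders[of \<sigma>] by (cases \<sigma>) auto
  obtain a' \<tau>' where a': "\<sigma>' = a' # \<tau>'" using \<sigma>(2,4) length_avoiders[of \<sigma>'] by (cases \<sigma>') auto
  have "a \<ge> 1" "a' \<ge> 1" "a \<notin> set \<tau>" "a' \<notin> set \<tau>'"
    using \<sigma>(1,2) a a' by (auto simp: avoiders_iff)
  have s: "set \<alpha> = {1..k}" "set \<alpha>' = {1..k'}" using \<alpha> by (auto simp: avoiders_iff)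
  then have n: "1 \<notin> set (map (\<lambda>x. x + a) \<alpha>)" "1 \<notin> set (map (\<lambda>x. x + a') \<alpha>')"
    using \<open>a \<ge> 1\<close> \<open>a' \<ge> 1\<close> by auto
  have eqs: "map (\<lambda>x. x + a) \<alpha> = map (\<lambda>x. x + a') \<alpha>'"
    "map (\<lambda>x. if x < a then Suc x else x + length \<alpha>) \<tau> =
     map (\<lambda>x. if x < a' then Suc x else x + length \<alpha>') \<tau>'"
  proof -
    have "1 \<notin> set (map (\<lambda>x. if x < a then Suc x else x + length \<alpha>) \<tau>)"
    proof -
      have "0 \<notin> set \<tau>" using \<sigma>(1) a by (auto simp: avoiders_iff)
      moreover have "length \<alpha> \<ge> 1" using \<alpha> length_avoiders by auto
      ultimately show ?thesis using \<open>a \<ge> 1\<close> by (auto split: if_splits)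
    qed
    from append_Cons_eq_iff[OF n(1) this] eq
    show "map (\<lambda>x. x + a) \<alpha> = map (\<lambda>x. x + a') \<alpha>'"
      "map (\<lambda>x. if x < a then Suc x else x + length \<alpha>) \<tau> =
       map (\<lambda>x. if x < a' then Suc x else x + length \<alpha>') \<tau>'"
      unfolding inflate_def a a' by simp_all
  qed
  then have len: "length \<alpha> = length \<alpha>'" using map_eq_imp_length_eq by blast
  then show "k = k'" using \<alpha> length_avoiders by auto
  have "(\<lambda>x. x + a) ` {1..k} = (\<lambda>x. x + a') ` {1..k'}"
    using arg_cong[OF eqs(1), of set] s by simp
  then have "{1 + a..k + a} = {1 + a'..k' + a'}" by simp
  then have [simp]: "a' = a" using \<alpha>(3,4) by simp
  show "\<alpha> = \<alpha>'" using eqs(1) by (auto simp: inj_map_eq_map inj_def)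
  have "inj_on (\<lambda>x. if x < a then Suc x else x + length \<alpha>) (set \<tau> \<union> set \<tau>')"
    using \<open>a \<notin> set \<tau>\<close> \<open>a' \<notin> set \<tau>'\<close> unfolding inj_on_def
    by (auto split: if_splits) (metis Suc_leI le_add1 le_antisym le_trans not_less)+
  moreover have "map (\<lambda>x. if x < a then Suc x else x + length \<alpha>) \<tau> =
      map (\<lambda>x. if x < a then Suc x else x + length \<alpha>) \<tau>'"
    using eqs(2) unfolding len[symmetric] by simp
  ultimately have "\<tau> = \<tau>'" by (rule map_inj_on[rotated])
  then show "\<sigma> = \<sigma>'" using a a' by simp
qed

text \<open>Collects the statistics in terms of \<open>\<alpha>\<close> and \<open>\<sigma>\<close>
  separately, so that weights built from them factor.\<close>

lemma inflate_avoiders: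
  assumes "\<alpha> \<in> avoiders k" "\<sigma> \<in> avoiders m" "k \<ge> 1" "m \<ge> 1"
  shows "inflate \<alpha> \<sigma> \<in> avoiders (k + m)"
    and "hd (inflate \<alpha> \<sigma>) \<noteq> 1"
    and "des (inflate \<alpha> \<sigma>) = des \<alpha> + 1 + des (tl \<sigma>)"
    and "des (tl (inflate \<alpha> \<sigma>)) = des (tl \<alpha>) + (if length \<alpha> = 1 then 0 else 1) + des (tl \<sigma>)"
    and "ides (inflate \<alpha> \<sigma>) = ides \<alpha> + ides \<sigma> + (if hd \<sigma> = 1 then 1 else 0)"
proof -
  obtain a \<tau> where a: "\<sigma> = a # \<tau>" using assms length_avoiders[of \<sigma>] by (cases \<sigma>) auto
  have \<alpha>: "distinct \<alpha>" "set \<alpha> = {1..k}" "\<alpha> \<noteq> []" and av: "avoids \<alpha>" "avoids (a # \<tau>)"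
    and \<sigma>: "distinct (a # \<tau>)" "set (a # \<tau>) = {1..m}"
    using assms a by (auto simp: avoiders_iff)
  have "a \<in> {1..m}" "hd \<alpha> \<in> {1..k}" unfolding \<sigma>(2)[symmetric] \<alpha>(2)[symmetric] using \<alpha>(3) by auto
  then have "a \<ge> 1" "hd \<alpha> \<ge> 1" by auto
  show "inflate \<alpha> \<sigma> \<in> avoiders (k + m)"
    using inflate_perm[OF \<alpha>(1,2) \<sigma>] avoids_inflate[OF \<alpha> \<sigma>] av by (simp add: avoiders_iff a)
  show "hd (inflate \<alpha> \<sigma>) \<noteq> 1"
    using \<open>a \<ge> 1\<close> \<open>hd \<alpha> \<ge> 1\<close> \<alpha>(3) by (simp add: inflate_def a hd_append hd_map)
  show "des (inflate \<alpha> \<sigma>) = des \<alpha> + 1 + des (tl \<sigma>)"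
    using des_inflate(1)[OF \<alpha> \<sigma>] by (simp add: a)
  have "tl \<alpha> = [] \<longleftrightarrow> length \<alpha> = 1" using \<alpha>(3) by (cases \<alpha>) auto
  then show "des (tl (inflate \<alpha> \<sigma>)) = des (tl \<alpha>) + (if length \<alpha> = 1 then 0 else 1) + des (tl \<sigma>)"
    using des_inflate(2)[OF \<alpha> \<sigma>] by (simp add: a)
  show "ides (inflate \<alpha> \<sigma>) = ides \<alpha> + ides \<sigma> + (if hd \<sigma> = 1 then 1 else 0)"
    using ides_inflate[OF \<alpha> \<sigma>] by (simp add: a)
qed

lemma avoiders_Suc:
  "avoiders (Suc n) = (\<lambda>\<beta>. 1 # map Suc \<beta>) ` avoiders n \<union>
     (\<lambda>(k, \<alpha>, \<sigma>). inflate \<alpha> \<sigma>) ` (SIGMA k:{1..n}. avoiders k \<times> avoiders (Suc n - k))"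
  (is "_ = ?L \<union> ?R")
proof (intro equalityI subsetI)
  fix \<pi> assume \<pi>: "\<pi> \<in> avoiders (Suc n)"
  then have "1 \<in> set \<pi>" by (auto simp: avoiders_iff)
  then obtain A B where AB: "\<pi> = A @ 1 # B" by (meson split_list)
  show "\<pi> \<in> ?L \<union> ?R"
  proof (cases "A = []")
    case True
    then obtain \<beta> where "\<beta> \<in> avoiders n" "B = map Suc \<beta>"
      using Cons_1_avoidersE[of B n] \<pi> AB by auto
    then show ?thesis using AB True by auto
  next
    case False
    obtain k \<alpha> \<sigma> where "k \<in> {1..<Suc n}" "\<alpha> \<in> avoiders k" "\<sigma> \<in> avoiders (Suc n - k)" "\<pi> = inflate \<alpha> \<sigma>"
      by (rule inflateE[OF \<pi> AB False])
    then have "(k, \<alpha>, \<sigma>) \<in> (SIGMA k:{1..n}. avoiders k \<times> avoiders (Suc n - k))" by auto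
    then show ?thesis using \<open>\<pi> = inflate \<alpha> \<sigma>\<close> by force
  qed
next
  fix \<pi> assume "\<pi> \<in> ?L \<union> ?R"
  then consider \<beta> where "\<beta> \<in> avoiders n" "\<pi> = 1 # map Suc \<beta>"
    | k \<alpha> \<sigma> where "k \<in> {1..n}" "\<alpha> \<in> avoiders k" "\<sigma> \<in> avoiders (Suc n - k)" "\<pi> = inflate \<alpha> \<sigma>"
    by auto
  then show "\<pi> \<in> avoiders (Suc n)"
  proof cases
    case 1
    then show ?thesis using Cons_1_avoiders(1) by simp
  next
    case 2
    then have "k + (Suc n - k) = Suc n" by auto
    then show ?thesis using inflate_avoiders(1)[OF 2(2,3)] 2 by auto
  qed
qed

text \<open>The two kinds of avoiders are told apart by whether the first letter is 1.
  \<open>F\<close> stays arbitrary because several weights use the same recursion.\<close>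

lemma sum_avoiders_Suc:
  fixes F :: "nat list \<Rightarrow> 'a::comm_monoid_add"
  shows "(\<Sum>\<pi>\<in>avoiders (Suc n). F \<pi>) = (\<Sum>\<beta>\<in>avoiders n. F (1 # map Suc \<beta>)) +
     (\<Sum>k=1..n. \<Sum>\<alpha>\<in>avoiders k. \<Sum>\<sigma>\<in>avoiders (Suc n - k). F (inflate \<alpha> \<sigma>))"
proof -
  let ?f = "\<lambda>\<beta>. 1 # map Suc \<beta>" and ?g = "\<lambda>(k::nat, \<alpha>, \<sigma>). inflate \<alpha> \<sigma>"
  let ?X = "SIGMA k:{1..n}. avoiders k \<times> avoiders (Suc n - k)"
  have "hd \<pi> \<noteq> 1" if "\<pi> \<in> ?g ` ?X" for \<pi>
    using that inflate_avoiders(2) by fastforce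
  moreover have "hd \<pi> = 1" if "\<pi> \<in> ?f ` avoiders n" for \<pi>
    using that by auto
  ultimately have disj: "?f ` avoiders n \<inter> ?g ` ?X = {}" by blast
  have injf: "inj_on ?f (avoiders n)" by (auto simp: inj_on_def inj_map_eq_map)
  have injg: "inj_on ?g ?X"
  proof (rule inj_onI, clarify)
    fix k \<alpha> \<sigma> k' \<alpha>' \<sigma>'
    assume *: "k \<in> {1..n}" "\<alpha> \<in> avoiders k" "\<sigma> \<in> avoiders (Suc n - k)"
      "k' \<in> {1..n}" "\<alpha>' \<in> avoiders k'" "\<sigma>' \<in> avoiders (Suc n - k')" "inflate \<alpha> \<sigma> = inflate \<alpha>' \<sigma>'"
    then have "k \<ge> 1" "k' \<ge> 1" "Suc n - k \<ge> 1" "Suc n - k' \<ge> 1" by auto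
    from inflate_inject[OF *(2,5) this(1,2) *(3,6) this(3,4) *(7)]
    show "k = k' \<and> (\<alpha>, \<sigma>) = (\<alpha>', \<sigma>')" by simp
  qed
  have "(\<Sum>\<pi>\<in>avoiders (Suc n). F \<pi>) = sum F (?f ` avoiders n) + sum F (?g ` ?X)"
    unfolding avoiders_Suc using disj
    by (intro sum.union_disjoint) (auto intro!: finite_avoiders)
  also have "sum F (?f ` avoiders n) = (\<Sum>\<beta>\<in>avoiders n. F (?f \<beta>))"
    using sum.reindex[OF injf, of F] by (simp add: o_def)
  also have "sum F (?g ` ?X) = (\<Sum>(k, \<alpha>, \<sigma>)\<in>?X. F (inflate \<alpha> \<sigma>))"
    using sum.reindex[OF injg, of F] by (simp add: o_def case_prod_unfold)
  also have "\<dots> = (\<Sum>k=1..n. \<Sum>(\<alpha>, \<sigma>)\<in>avoiders k \<times> avoiders (Suc n - k). F (inflate \<alpha> \<sigma>))"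
    by (subst sum.Sigma) (auto simp: finite_avoiders)
  also have "\<dots> = (\<Sum>k=1..n. \<Sum>\<alpha>\<in>avoiders k. \<Sum>\<sigma>\<in>avoiders (Suc n - k). F (inflate \<alpha> \<sigma>))"
    by (intro sum.cong refl sum.cartesian_product[symmetric])
  finally show ?thesis .
qed

section \<open>Generating functions of weighted avoiders\<close>

definition avoiders_gf :: "(nat list \<Rightarrow> 'a::comm_ring_1) \<Rightarrow> 'a fps" where
  "avoiders_gf F = Abs_fps (\<lambda>n. if n = 0 then 0 else \<Sum>\<pi>\<in>avoiders n. F \<pi>)"

lemma avoiders_gf_cong:
  "(\<And>n \<pi>. n > 0 \<Longrightarrow> \<pi> \<in> avoiders n \<Longrightarrow> F \<pi> = G \<pi>) \<Longrightarrow> avoiders_gf F = avoiders_gf G"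
  by (auto simp: avoiders_gf_def fps_eq_iff intro!: sum.cong)

lemma avoiders_gf_add: "avoiders_gf (\<lambda>\<pi>. F \<pi> + G \<pi>) = avoiders_gf F + avoiders_gf G"
  by (auto simp: avoiders_gf_def fps_eq_iff sum.distrib)

lemma avoiders_gf_cmult: "avoiders_gf (\<lambda>\<pi>. c * F \<pi>) = fps_const c * avoiders_gf F"
  by (auto simp: avoiders_gf_def fps_eq_iff sum_distrib_left)

lemma avoiders_gf_zero: "avoiders_gf (\<lambda>\<pi>. 0) = 0"
  by (auto simp: avoiders_gf_def fps_eq_iff)

lemma avoiders_1: "avoiders (Suc 0) = {[1]}"
proof -
  have "\<pi> = [1]" if "\<pi> \<in> avoiders (Suc 0)" for \<pi>
    using that length_avoiders[OF that] by (cases \<pi>) (auto simp: avoiders_iff)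
  moreover have "[1] \<in> avoiders (Suc 0)" by (auto simp: avoiders_iff avoids_def)
  ultimately show ?thesis by blast
qed

lemma ides_singleton: "ides [1] = 0"
  using ides_eq[of "[1]" 1] by simp

text \<open>Source of the summand \<open>z\<close> in the equation for \<open>D\<close>.\<close>

lemma avoiders_gf_singleton: "avoiders_gf (\<lambda>\<pi>. if length \<pi> = 1 then 1 else 0) = fps_X"
proof (rule fps_ext)
  fix n :: nat
  have "(\<Sum>\<pi>\<in>avoiders n. if length \<pi> = 1 then 1 else 0) = (\<Sum>\<pi>\<in>avoiders n. if n = 1 then 1 else (0::'a))"
    by (intro sum.cong) (auto simp: length_avoiders)
  then show "avoiders_gf (\<lambda>\<pi>. if length \<pi> = 1 then 1 else 0) $ n = (fps_X :: 'a fps) $ n"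
    by (auto simp: avoiders_gf_def avoiders_1)
qed

text \<open>A weight that factors over \<open>inflate\<close> turns the decomposition into a product
  of series. As \<open>avoiders_gf\<close> omits the empty word, the case of empty
  \<open>\<beta>\<close> enters as the constant \<open>F [1]\<close>.\<close>

lemma avoiders_gf_inflate:
  assumes "\<And>k m \<alpha> \<sigma>. \<alpha> \<in> avoiders k \<Longrightarrow> \<sigma> \<in> avoiders m \<Longrightarrow> k \<ge> 1 \<Longrightarrow> m \<ge> 1 \<Longrightarrow>
      F (inflate \<alpha> \<sigma>) = G \<alpha> * H \<sigma>"
  shows "avoiders_gf F = fps_X * (fps_const (F [1]) + avoiders_gf (\<lambda>\<beta>. F (1 # map Suc \<beta>)))
    + avoiders_gf G * avoiders_gf H"
proof (rule fps_ext)
  fix n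
  show "avoiders_gf F $ n = (fps_X * (fps_const (F [1]) + avoiders_gf (\<lambda>\<beta>. F (1 # map Suc \<beta>)))
    + avoiders_gf G * avoiders_gf H) $ n"
  proof (cases n)
    case 0
    then show ?thesis by (simp add: avoiders_gf_def)
  next
    case (Suc m)
    have "(\<Sum>k=1..m. \<Sum>\<alpha>\<in>avoiders k. \<Sum>\<sigma>\<in>avoiders (Suc m - k). F (inflate \<alpha> \<sigma>)) =
      (\<Sum>k=1..m. avoiders_gf G $ k * avoiders_gf H $ (Suc m - k))"
    proof (rule sum.cong[OF refl])
      fix k assume k: "k \<in> {1..m}"
      have "(\<Sum>\<alpha>\<in>avoiders k. \<Sum>\<sigma>\<in>avoiders (Suc m - k). F (inflate \<alpha> \<sigma>)) =
        (\<Sum>\<alpha>\<in>avoiders k. \<Sum>\<sigma>\<in>avoiders (Suc m - k). G \<alpha> * H \<sigma>)"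
        using k by (intro sum.cong assms) auto
      then show "(\<Sum>\<alpha>\<in>avoiders k. \<Sum>\<sigma>\<in>avoiders (Suc m - k). F (inflate \<alpha> \<sigma>)) =
        avoiders_gf G $ k * avoiders_gf H $ (Suc m - k)"
        using k by (auto simp: avoiders_gf_def sum_product)
    qed
    \<comment> \<open>The added end terms vanish because both series have constant term 0.\<close>
    also have "\<dots> = (\<Sum>k=0..Suc m. avoiders_gf G $ k * avoiders_gf H $ (Suc m - k))"
    proof (rule sum.mono_neutral_left)
      show "\<forall>k\<in>{0..Suc m} - {1..m}. avoiders_gf G $ k * avoiders_gf H $ (Suc m - k) = 0"
      proof
        fix k assume "k \<in> {0..Suc m} - {1..m}"
        then have "k = 0 \<or> k = Suc m" by auto
        then show "avoiders_gf G $ k * avoiders_gf H $ (Suc m - k) = 0"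
          by (auto simp: avoiders_gf_def)
      qed
    qed auto
    also have "\<dots> = (avoiders_gf G * avoiders_gf H) $ n"
      by (simp add: fps_mult_nth Suc)
    finally have "avoiders_gf F $ n =
      (\<Sum>\<beta>\<in>avoiders m. F (1 # map Suc \<beta>)) + (avoiders_gf G * avoiders_gf H) $ n"
      by (simp add: avoiders_gf_def Suc sum_avoiders_Suc)
    moreover have "(\<Sum>\<beta>\<in>avoiders m. F (1 # map Suc \<beta>)) =
      (fps_const (F [1]) + avoiders_gf (\<lambda>\<beta>. F (1 # map Suc \<beta>))) $ m"
      by (auto simp: avoiders_gf_def avoiders_0)
    ultimately show ?thesis by (simp add: Suc)
  qed
qed

section \<open>Cancellation and elimination over a commutative ring\<close>

text \<open>The coefficient ring may have zero divisors, so cancellation is done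
  coefficientwise.\<close>

lemma fps_X_mult_cancel:
  fixes f g :: "'a::comm_ring_1 fps"
  assumes "fps_X * f = fps_X * g"
  shows "f = g"
proof (rule fps_ext)
  fix n
  show "f $ n = g $ n" using arg_cong[OF assms, of "\<lambda>h. h $ Suc n"] by simp
qed

text \<open>From \<open>g = - (f * g)\<close> and the zero constant term of \<open>f\<close>, each
  coefficient of \<open>g\<close> depends only on earlier ones, which vanish by induction.\<close>

lemma fps_one_plus_mult_eq_0:
  fixes f g :: "'a::comm_ring_1 fps"
  assumes "f $ 0 = 0" "(1 + f) * g = 0"
  shows "g = 0"
proof (rule fps_ext)
  fix n
  show "g $ n = 0 $ n"
  proof (induction n rule: less_induct)
    case (less n)
    have "(\<Sum>i=0..n. f $ i * g $ (n - i)) = 0"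
    proof (rule sum.neutral, rule ballI)
      fix i assume "i \<in> {0..n}"
      then show "f $ i * g $ (n - i) = 0"
        using assms(1) less[of "n - i"] by (cases "i = 0") auto
    qed
    then have "(f * g) $ n = 0" by (simp add: fps_mult_nth)
    moreover have "g = - (f * g)" using assms(2) by (simp add: algebra_simps eq_neg_iff_add_eq_0)
    ultimately show ?case by (metis fps_neg_nth fps_zero_nth neg_0_equal_iff_equal)
  qed
qed

lemma fps_const_diff_1: "fps_const (c - 1) = fps_const c - (1 :: 'a::comm_ring_1 fps)"
  by (simp add: fps_eq_iff)

lemma fps_const_1_diff: "fps_const (1 - c) = (1 :: 'a::comm_ring_1 fps) - fps_const c"
  by (simp add: fps_eq_iff)

lemma fps_const_add_1: "fps_const (c + 1) = fps_const c + (1 :: 'a::comm_ring_1 fps)"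
  by (simp add: fps_eq_iff)

lemma fps_const_numeral: "fps_const (numeral k) = (numeral k :: 'a::comm_ring_1 fps)"
  by (simp add: numeral_fps_const)

text \<open>Substitute \<open>z * (1 + S) = S - t * S * W\<close> and then
  \<open>D - t * D * W = z * W\<close>. The factor \<open>z\<close> stays, to be cancelled when it
  is \<open>fps_X\<close>.\<close>

lemma system_cross_mult:
  fixes S D W z t :: "'a::comm_ring_1"
  assumes S: "S = z * (1 + S) + t * S * W" and D: "D = (t * D + z) * W"
  shows "z * (D * (1 + S)) = z * (W * S)"
proof -
  have "z * (1 + S) = S - t * S * W" using S by (simp add: eq_diff_eq)
  then have "z * (D * (1 + S)) = D * (S - t * S * W)" by (simp add: mult.left_commute)
  also have "\<dots> = S * (D - t * D * W)" by (simp add: algebra_simps)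
  also have "D - t * D * W = z * W" using D by (simp add: diff_eq_eq algebra_simps)
  finally show ?thesis by (simp add: mult_ac)
qed

text \<open>Multiplying the equation for \<open>W\<close> by \<open>1 + S\<close> removes
  \<open>D\<close> and gives a closed form of \<open>W * (1 + t * S)\<close>; multiplying the
  equation for \<open>S\<close> by \<open>1 + t * S\<close> then removes \<open>W\<close> without
  division.\<close>

lemma system_eliminate:
  fixes S D W z s t :: "'a::comm_ring_1"
  assumes S: "S = z * (1 + S) + t * S * W" and DT: "D * (1 + S) = W * S"
    and W: "W = S + (s - 1) * (z * (1 + S)) + (1 - t) * D"
  shows "S = t * (z * (s - 1) + 1) * S ^ 3 + t * z * (2 * s - 1) * S ^ 2 + z * (t * s + 1) * S + z"
proof -
  have "W * (1 + S) = (S + (s - 1) * (z * (1 + S)) + (1 - t) * D) * (1 + S)"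
    by (rule arg_cong[OF W])
  also have "\<dots> = (S + (s - 1) * (z * (1 + S))) * (1 + S) + (1 - t) * (D * (1 + S))"
    by (simp only: distrib_right mult.assoc)
  finally have "W * (1 + S) = (S + (s - 1) * (z * (1 + S))) * (1 + S) + (1 - t) * (W * S)"
    unfolding DT .
  then have W': "W * (1 + t * S) = (S + (s - 1) * (z * (1 + S))) * (1 + S)"
    by (simp add: algebra_simps)
  have "S * (1 + t * S) = (z * (1 + S) + t * S * W) * (1 + t * S)"
    by (rule arg_cong[OF S])
  also have "\<dots> = z * (1 + S) * (1 + t * S) + t * S * (W * (1 + t * S))"
    by (simp only: distrib_right mult.assoc)
  finally have "S * (1 + t * S) =
      z * (1 + S) * (1 + t * S) + t * S * ((S + (s - 1) * (z * (1 + S))) * (1 + S))"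
    unfolding W' .
  \<comment> \<open>The term \<open>t * S ^ 2\<close> occurs on both sides and cancels.\<close>
  then show ?thesis by (simp add: algebra_simps power2_eq_square power3_eq_cube)
qed

lemma cubic_factor:
  fixes S z s :: "'a::comm_ring_1"
  assumes "S = (z * (s - 1) + 1) * S ^ 3 + z * (2 * s - 1) * S ^ 2 + z * (s + 1) * S + z"
  shows "(1 + S) * ((s * z - z + 1) * S ^ 2 + s * z * S + z - S) = 0"
proof -
  have "(1 + S) * ((s * z - z + 1) * S ^ 2 + s * z * S + z - S) =
      (z * (s - 1) + 1) * S ^ 3 + z * (2 * s - 1) * S ^ 2 + z * (s + 1) * S + z - S"
    by (simp add: algebra_simps power2_eq_square power3_eq_cube)
  then show ?thesis unfolding assms[symmetric] by simp
qed

section \<open>The system for \<open>S\<close>, \<open>D\<close>, \<open>W\<close> and its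
  consequences\<close>

lemma S_gf_cubic:
  fixes s t :: "'a::comm_ring_1"
  shows "S_gf s t = fps_const t * (fps_X * fps_const (s - 1) + 1) * S_gf s t ^ 3
           + fps_const t * fps_X * fps_const (2 * s - 1) * S_gf s t ^ 2
           + fps_X * fps_const (t * s + 1) * S_gf s t + fps_X"
proof -
  define wS where "wS \<pi> = s ^ ides \<pi> * t ^ des \<pi>" for \<pi>
  \<comment> \<open>The condition \<open>des (tl \<pi>) < des \<pi>\<close> says that
    \<open>\<pi>\<close> begins with a descent.\<close>
  define wD where "wD \<pi> = (if des (tl \<pi>) < des \<pi> then s ^ ides \<pi> * t ^ des (tl \<pi>) else 0)" for \<pi>
  define wW where "wW \<pi> = s ^ (ides \<pi> + (if hd \<pi> = 1 then 1 else 0)) * t ^ des (tl \<pi>)" for \<pi>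
  define w1 where "w1 \<pi> = (if hd \<pi> = 1 then wS \<pi> else 0)" for \<pi>
  define S where "S = avoiders_gf wS"
  define D where "D = avoiders_gf wD"
  define W where "W = avoiders_gf wW"
  have S_gf: "S_gf s t = S" by (simp add: S_gf_def S_def avoiders_gf_def wS_def[abs_def])
  have sing: "wS [1] = 1" "wD [1] = 0" "w1 [1] = 1"
    using ides_singleton by (simp_all add: wS_def wD_def w1_def)
  have Cons1: "wS (1 # map Suc \<beta>) = wS \<beta>" "wD (1 # map Suc \<beta>) = 0" if "\<beta> \<in> avoiders n" for \<beta> n
  proof -
    have "des (map Suc \<beta>) = des \<beta>" by (rule des_map) auto
    then show "wS (1 # map Suc \<beta>) = wS \<beta>" "wD (1 # map Suc \<beta>) = 0"
      using Cons_1_avoiders(2,3)[OF that] by (simp_all add: wS_def wD_def)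
  qed
  have gf_Cons1: "avoiders_gf (\<lambda>\<beta>. wS (1 # map Suc \<beta>)) = S" "avoiders_gf (\<lambda>\<beta>. wD (1 # map Suc \<beta>)) = 0"
    unfolding S_def using Cons1 avoiders_gf_zero
    by (auto intro: avoiders_gf_cong intro!: trans[OF avoiders_gf_cong avoiders_gf_zero])
  have "S = fps_X * (fps_const (wS [1]) + avoiders_gf (\<lambda>\<beta>. wS (1 # map Suc \<beta>)))
      + avoiders_gf (\<lambda>\<alpha>. t * wS \<alpha>) * W"
    unfolding S_def W_def
  proof (rule avoiders_gf_inflate)
    fix k m \<alpha> \<sigma>
    assume "\<alpha> \<in> avoiders k" "\<sigma> \<in> avoiders m" "k \<ge> 1" "m \<ge> 1"
    from inflate_avoiders[OF this] show "wS (inflate \<alpha> \<sigma>) = t * wS \<alpha> * wW \<sigma>"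
      by (simp only: wS_def wW_def power_add mult_ac power_one_right)
  qed
  then have eqS: "S = fps_X * (1 + S) + fps_const t * S * W"
    unfolding sing gf_Cons1 avoiders_gf_cmult S_def[symmetric] fps_const_1_eq_1 .
  have "D = fps_X * (fps_const (wD [1]) + avoiders_gf (\<lambda>\<beta>. wD (1 # map Suc \<beta>)))
      + avoiders_gf (\<lambda>\<alpha>. t * wD \<alpha> + (if length \<alpha> = 1 then 1 else 0)) * W"
    unfolding D_def W_def
  proof (rule avoiders_gf_inflate)
    fix k m \<alpha> \<sigma>
    assume *: "\<alpha> \<in> avoiders k" "\<sigma> \<in> avoiders m" "k \<ge> 1" "m \<ge> 1"
    show "wD (inflate \<alpha> \<sigma>) = (t * wD \<alpha> + (if length \<alpha> = 1 then 1 else 0)) * wW \<sigma>"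
    \<comment> \<open>Over a one-letter block the initial descent is the step down to 1, which
      \<open>wD\<close> does not weight. A longer block starts as \<open>\<alpha>\<close> does, and
      its step down to 1 contributes the factor \<open>t\<close>.\<close>
    proof (cases "length \<alpha> = 1")
      case True
      then have "\<alpha> = [1]" using *(1) length_avoiders[OF *(1)] avoiders_1 by auto
      then have "ides \<alpha> = 0" "des \<alpha> = 0" "des (tl \<alpha>) = 0" "wD \<alpha> = 0"
        using sing(2) ides_singleton by simp_all
      with True show ?thesis
        by (simp add: wD_def[of "inflate _ _"] wW_def inflate_avoiders(3-5)[OF *])
    next
      case False
      have "wD (inflate \<alpha> \<sigma>) = (if des (tl \<alpha>) < des \<alpha>
          then s ^ (ides \<alpha> + ides \<sigma> + (if hd \<sigma> = 1 then 1 else 0)) * t ^ (des (tl \<alpha>) + 1 + des (tl \<sigma>)) else 0)"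
        using False by (simp add: wD_def inflate_avoiders(3-5)[OF *])
      also have "\<dots> = t * wD \<alpha> * wW \<sigma>"
        by (simp only: wD_def wW_def power_add power_one_right mult_ac split: if_split) simp
      finally show ?thesis using False by simp
    qed
  qed
  then have eqD: "D = (fps_const t * D + fps_X) * W"
    unfolding sing gf_Cons1 avoiders_gf_add avoiders_gf_cmult avoiders_gf_singleton D_def[symmetric]
      fps_const_0_eq_0 add_0_left mult_zero_right .
  \<comment> \<open>An inflation never begins with 1, so the product part has weight 0.\<close>
  have "avoiders_gf w1 = fps_X * (fps_const (w1 [1]) + avoiders_gf (\<lambda>\<beta>. w1 (1 # map Suc \<beta>)))
      + avoiders_gf (\<lambda>\<alpha>. 0) * W"
    unfolding W_def by (rule avoiders_gf_inflate) (use inflate_avoiders(2) in \<open>auto simp: w1_def\<close>)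
  then have gf_w1: "avoiders_gf w1 = fps_X * (1 + S)"
    using gf_Cons1(1) sing(3) by (simp add: avoiders_gf_zero w1_def[of "_ # _"])
  \<comment> \<open>If \<open>\<sigma>\<close> begins with 1, then \<open>wW\<close> is
    \<open>s * wS\<close>; if it begins with a descent, then \<open>wS = t * wD\<close> and
    \<open>wW = wD\<close>; otherwise \<open>wW = wS\<close>.\<close>
  have "W = avoiders_gf (\<lambda>\<sigma>. wS \<sigma> + ((s - 1) * w1 \<sigma> + (1 - t) * wD \<sigma>))"
    unfolding W_def
  proof (rule avoiders_gf_cong)
    fix n :: nat and \<sigma> assume \<sigma>: "n > 0" "\<sigma> \<in> avoiders n"
    then obtain a \<tau> where a: "\<sigma> = a # \<tau>" using length_avoiders[of \<sigma>] by (cases \<sigma>) auto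
    have pos: "\<forall>x\<in>set \<tau>. 1 \<le> x" using \<sigma>(2) a by (auto simp: avoiders_iff)
    have "des \<sigma> = des \<tau> \<or> des \<sigma> = Suc (des \<tau>)"
      unfolding a by (cases \<tau>) (auto simp: des_Cons_Cons)
    moreover have "des \<sigma> = des \<tau>" if "a = 1"
      unfolding a that using pos by (rule des_Cons_least)
    ultimately show "wW \<sigma> = wS \<sigma> + ((s - 1) * w1 \<sigma> + (1 - t) * wD \<sigma>)"
      by (auto simp: wW_def wS_def w1_def wD_def a algebra_simps)
  qed
  then have eqW: "W = S + (fps_const s - 1) * (fps_X * (1 + S)) + (1 - fps_const t) * D"
    unfolding avoiders_gf_add avoiders_gf_cmult gf_w1 S_def[symmetric] D_def[symmetric] add.assoc
      fps_const_diff_1 fps_const_1_diff .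
  have "D * (1 + S) = W * S"
    using system_cross_mult[OF eqS eqD] by (rule fps_X_mult_cancel)
  from system_eliminate[OF eqS this eqW] show ?thesis
    unfolding S_gf fps_const_diff_1 fps_const_mult[symmetric] fps_const_add_1 fps_const_numeral .
qed

text \<open>At \<open>t = 1\<close> the cubic has the factor \<open>1 + S\<close>, which cancels
  because \<open>S\<close> has constant term 0.\<close>

lemma S_gf_quadratic:
  fixes s :: "'a::comm_ring_1"
  shows "S_gf s 1 = (fps_const s * fps_X - fps_X + 1) * S_gf s 1 ^ 2
           + fps_const s * fps_X * S_gf s 1 + fps_X"
proof -
  define S where "S = S_gf s 1"
  define E where "E = (fps_const s * fps_X - fps_X + 1) * S ^ 2 + fps_const s * fps_X * S + fps_X - S"
  have "S = (fps_X * fps_const (s - 1) + 1) * S ^ 3 + fps_X * fps_const (2 * s - 1) * S ^ 2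
           + fps_X * fps_const (s + 1) * S + fps_X"
    unfolding S_def by (rule trans[OF S_gf_cubic]) simp
  then have "S = (fps_X * (fps_const s - 1) + 1) * S ^ 3 + fps_X * (2 * fps_const s - 1) * S ^ 2
           + fps_X * (fps_const s + 1) * S + fps_X"
    unfolding fps_const_diff_1 fps_const_mult[symmetric] fps_const_add_1 fps_const_numeral .
  then have "(1 + S) * E = 0" unfolding E_def by (rule cubic_factor)
  moreover have "S $ 0 = 0" by (simp add: S_def S_gf_def)
  ultimately have "E = 0" by (rule fps_one_plus_mult_eq_0[rotated])
  then show ?thesis unfolding E_def S_def[symmetric] right_minus_eq by (rule sym)
qed

theorem theorem4p4:
  fixes s t :: "'a::comm_ring_1"
  shows "(S_gf s t = fps_const t * (fps_X * fps_const (s - 1) + 1) * S_gf s t ^ 3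
           + fps_const t * fps_X * fps_const (2 * s - 1) * S_gf s t ^ 2
           + fps_X * fps_const (t * s + 1) * S_gf s t + fps_X)
       \<and> (S_gf 1 t = fps_const t * S_gf 1 t ^ 3 + fps_const t * fps_X * S_gf 1 t ^ 2
           + fps_X * fps_const (t + 1) * S_gf 1 t + fps_X)
       \<and> (S_gf s 1 = (fps_const s * fps_X - fps_X + 1) * S_gf s 1 ^ 2
           + fps_const s * fps_X * S_gf s 1 + fps_X)"
proof (intro conjI)
  show "S_gf 1 t = fps_const t * S_gf 1 t ^ 3 + fps_const t * fps_X * S_gf 1 t ^ 2
           + fps_X * fps_const (t + 1) * S_gf 1 t + fps_X"
    by (rule trans[OF S_gf_cubic]) simp
qed (rule S_gf_cubic S_gf_quadratic)+

end
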